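(* Let $G$ be a finite abelian group and consider the hidden subgroup problem on $G$ with candidate hidden subgroups $\{H_j\}_{j\in\mathcal J}$ occurring with probabilities $p_j$. Let $\sigma_j$ be the state of the input register at the end of the single-query Shor–Kitaev circuit (after the quantum Fourier transform, before measurement), conditioned on class $j$ with the output register traced out. For an integer $t\ge1$ let $\rho_Y^{(t)}=\sum_{j\in\mathcal J}p_j\sigma_j^{\otimes t}$, and let $Y_t$ be the outcome of measuring all $t$ input registers in the computational basis when the state is $\sigma_j^{\otimes t}$ given $J=j$. Write $Y=Y_1$ for the single-query outcome. Then: (a) all $\sigma_j^{\otimes t}$ and $\rho_Y^{(t)}$ are diagonal in the tensor product computational basis; identifying basis states with tuples $(\chi_1,\dots,\chi_t)\in\hat G^t$, the eigenvalues of $\rho_Y^{(t)}$ are $$\lambda(\chi_1,\dots,\chi_t)=\sum_{j\in\mathcal J:\ \chi_1,\dots,\chi_t\in H_j^\perp}p_j\left(\frac{|H_j|}{|G|}\right)^t;$$ (b) $H(Y_t)=S(\rho_Y^{(t)})$ and $$H(Y_t\mid J)=t\,H(Y\mid J)=t\Bigl(\log|G|-\sum_{j\in\mathcal J}p_j\log|H_j|\Bigr);$$ (c) $$I(J;Y_t)=S(\rho_Y^{(t)})-t\,H(Y\mid J)=\chi\bigl(\{\sigma_j^{\otimes t};p_j\}\bigr),$$ where $\chi(\{\sigma_j^{\otimes t};p_j\})=S(\rho_Y^{(t)})-\sum_jp_jS(\sigma_j^{\otimes t})$ is the Holevo quantity.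
   Context: Hidden subgroup problem: $\mathcal F$ is a finite set of functions $f:G\to X$ ($X$ a set), each hiding a subgroup $H\subseteq G$, meaning $f(g)=f(g')$ iff $g-g'\in H$. $\mathcal F$ is partitioned into nonempty classes $A_j$, $j\in\mathcal J$, where $A_j$ consists of the functions in $\mathcal F$ hiding $H_j$ (distinct $j$ give distinct subgroups). $F$ is random with $\Pr(F=f)=p_f$, $J$ is its class, and $p_j=\sum_{f\in A_j}p_f>0$. Write $G=\prod_{i=1}^M\mathbb Z/d_i\mathbb Z$. $\hat G=\mathrm{Hom}(G,\mathrm U(1))$ is the character group; for $g=(g_1,\dots,g_M)\in G$ let $\chi_g\in\hat G$ be $\chi_g(l_1,\dots,l_M)=\prod_ie^{2\pi\mathrm i\,l_ig_i/d_i}$; the map $g\mapsto\chi_g$ is a bijection $G\to\hat G$ used to identify the computational basis state $|g\rangle$ with the character $\chi_g$. $H_j^\perp\subseteq\hat G$ is the subgroup of characters trivial on $H_j$. The quantum Fourier transform on the input register is the unitary $W|x\rangle=|G|^{-1/2}\sum_{g\in G}\chi_g(x)|g\rangle$. The post-query state for oracle $f$ is $|\psi_2(f)\rangle=|G|^{-1/2}\sum_{g\in G}|g\rangle\otimes|f(g)\rangle$ (orthonormal bases $\{|g\rangle\}_{g\in G}$, $\{|x\rangle\}_{x\in X}$), the final state is $|\psi_{\mathrm{fin}}(f)\rangle=(W\otimes I)|\psi_2(f)\rangle$, and $\sigma_j=\frac1{p_j}\sum_{f\in A_j}p_f\,\mathrm{Tr}_O|\psi_{\mathrm{fin}}(f)\rangle\langle\psi_{\mathrm{fin}}(f)|$,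 where $\mathrm{Tr}_O$ traces out the second (output) register. The outcome satisfies $\Pr(Y_t=(g_1,\dots,g_t)\mid J=j)=\langle g_1,\dots,g_t|\sigma_j^{\otimes t}|g_1,\dots,g_t\rangle$. $H$ with random-variable arguments is Shannon entropy, $I$ mutual information, $S$ von Neumann entropy, with base-2 logarithms. *)

theory Defs
  imports
    "HOL-Probability.Probability"
    "HOL-Algebra.Elementary_Groups"
    "HOL-Algebra.Product_Groups"
    "Jordan_Normal_Form.Char_Poly"
begin

definition circle_group :: "complex monoid" where
  "circle_group = \<lparr>carrier = {z. cmod z = 1}, monoid.mult = (*), one = 1\<rparr>"

text \<open>Characters are made extensional so that a homomorphism on the carrier is
  represented by exactly one HOL function.\<close>

definition characters :: "('a, 'b) monoid_scheme \<Rightarrow> ('a \<Rightarrow> complex) set" where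
  "characters G = hom G circle_group \<inter> extensional (carrier G)"

definition annihilator ::
  "('a, 'b) monoid_scheme \<Rightarrow> 'a set \<Rightarrow> ('a \<Rightarrow> complex) set" where
  "annihilator G K = {\<kappa> \<in> characters G. \<forall>h\<in>K. \<kappa> h = 1}"

definition cyclic_product :: "nat \<Rightarrow> (nat \<Rightarrow> nat) \<Rightarrow> (nat \<Rightarrow> int) monoid" where
  "cyclic_product M d = product_group {1..M} (\<lambda>i. integer_mod_group (d i))"

text \<open>An isomorphism \<open>\<phi>\<close> from \<open>G\<close> to \<open>cyclic_product M d\<close> gives the coordinates
  \<open>g\<^sub>i = \<phi> g i\<close>; if \<open>G\<close> is literally the product, \<open>\<phi>\<close> is the identity.\<close>

definition chi ::
  "('a, 'b) monoid_scheme \<Rightarrow> nat \<Rightarrow> (nat \<Rightarrow> nat) \<Rightarrow> ('a \<Rightarrow> nat \<Rightarrow> int) \<Rightarrow> 'a \<Rightarrow> 'a \<Rightarrow> complex"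
where
  "chi G M d \<phi> g = (\<lambda>l\<in>carrier G.
     \<Prod>i=1..M. exp (2 * of_real pi * \<i> * of_int (\<phi> l i) * of_int (\<phi> g i) / of_nat (d i)))"

definition hides :: "('a, 'b) monoid_scheme \<Rightarrow> ('a \<Rightarrow> 'x) \<Rightarrow> 'a set \<Rightarrow> bool" where
  "hides G f K \<longleftrightarrow> subgroup K G \<and>
     (\<forall>g\<in>carrier G. \<forall>g'\<in>carrier G. f g = f g' \<longleftrightarrow> g \<otimes>\<^bsub>G\<^esub> inv\<^bsub>G\<^esub> g' \<in> K)"

definition hiding_class ::
  "('a, 'b) monoid_scheme \<Rightarrow> ('a \<Rightarrow> 'x) set \<Rightarrow> 'a set \<Rightarrow> ('a \<Rightarrow> 'x) set" where
  "hiding_class G \<F> K = {f \<in> \<F>. hides G f K}"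

text \<open>Vectors and operators are given by their coordinates and matrix entries in an
  orthonormal basis labelled by a set \<open>B\<close>; values at labels outside \<open>B\<close> are irrelevant.
  The output alphabet may be infinite, hence the unordered infinite sums. All of them have
  finitely many nonzero terms when applied to the states below.\<close>

type_synonym 'i vect = "'i \<Rightarrow> complex"
type_synonym 'i oper = "'i \<Rightarrow> 'i \<Rightarrow> complex"

definition ket :: "'i \<Rightarrow> 'i vect" where
  "ket b = (\<lambda>a. if a = b then 1 else 0)"

definition tensor_vec :: "'i vect \<Rightarrow> 'k vect \<Rightarrow> ('i \<times> 'k) vect" where
  "tensor_vec u v = (\<lambda>(a, x). u a * v x)"

definition id_op :: "'i oper" where
  "id_op = (\<lambda>a b. if a = b then 1 else 0)"

definition tensor_op :: "'i oper \<Rightarrow> 'k oper \<Rightarrow> ('i \<times> 'k) oper" where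
  "tensor_op A B = (\<lambda>(a, x) (b, y). A a b * B x y)"

definition apply_op :: "'i set \<Rightarrow> 'i oper \<Rightarrow> 'i vect \<Rightarrow> 'i vect" where
  "apply_op B A v = (\<lambda>a. \<Sum>\<^sub>\<infinity>b\<in>B. A a b * v b)"

definition ket_bra :: "'i vect \<Rightarrow> 'i oper" where
  "ket_bra v = (\<lambda>a b. v a * cnj (v b))"

definition partial_trace :: "'k set \<Rightarrow> ('i \<times> 'k) oper \<Rightarrow> 'i oper" where
  "partial_trace X R = (\<lambda>a b. \<Sum>\<^sub>\<infinity>x\<in>X. R (a, x) (b, x))"

text \<open>A basis state of the \<open>t\<close>-fold tensor power is labelled by a \<open>t\<close>-tuple of labels.\<close>

definition tuples :: "nat \<Rightarrow> 'i set \<Rightarrow> (nat \<Rightarrow> 'i) set" where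
  "tuples t B = ({1..t} \<rightarrow>\<^sub>E B)"

definition tensor_power :: "nat \<Rightarrow> 'i oper \<Rightarrow> (nat \<Rightarrow> 'i) oper" where
  "tensor_power t A = (\<lambda>a b. \<Prod>i=1..t. A (a i) (b i))"

definition diagonal_on :: "'i set \<Rightarrow> 'i oper \<Rightarrow> bool" where
  "diagonal_on B A \<longleftrightarrow> (\<forall>a\<in>B. \<forall>b\<in>B. a \<noteq> b \<longrightarrow> A a b = 0)"

text \<open>The matrix of an operator for a fixed enumeration of the finite label set. The
  characteristic polynomial does not depend on the enumeration.\<close>

definition matrix_on :: "'i set \<Rightarrow> 'i oper \<Rightarrow> complex mat" where
  "matrix_on B A =
     mat (card B) (card B) (\<lambda>(k, l). A (from_nat_into B k) (from_nat_into B l))"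

definition eigenvalues :: "'i set \<Rightarrow> 'i oper \<Rightarrow> complex multiset" where
  "eigenvalues B A = proots (char_poly (matrix_on B A))"

text \<open>The eigenvalues of a density operator are real and nonnegative. The convention
  \<open>0 log 0 = 0\<close> holds because \<open>0 * y = 0\<close>.\<close>

definition von_neumann_entropy :: "'i set \<Rightarrow> 'i oper \<Rightarrow> real" where
  "von_neumann_entropy B A = - (\<Sum>e\<in>#eigenvalues B A. Re e * log 2 (Re e))"

definition mixture :: "'j set \<Rightarrow> ('j \<Rightarrow> real) \<Rightarrow> ('j \<Rightarrow> 'i oper) \<Rightarrow> 'i oper" where
  "mixture \<J> q R = (\<lambda>a b. \<Sum>j\<in>\<J>. of_real (q j) * R j a b)"

definition holevo :: "'i set \<Rightarrow> 'j set \<Rightarrow> ('j \<Rightarrow> real) \<Rightarrow> ('j \<Rightarrow> 'i oper) \<Rightarrow> real" where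
  "holevo B \<J> q R = von_neumann_entropy B (mixture \<J> q R)
     - (\<Sum>j\<in>\<J>. q j * von_neumann_entropy B (R j))"

text \<open>Here \<open>c g\<close> stands for the character \<open>\<chi>\<^sub>g\<close>.\<close>

definition qft :: "('a, 'b) monoid_scheme \<Rightarrow> ('a \<Rightarrow> 'a \<Rightarrow> complex) \<Rightarrow> 'a oper" where
  "qft G c = (\<lambda>g x. c g x / of_real (sqrt (card (carrier G))))"

definition post_query :: "('a, 'b) monoid_scheme \<Rightarrow> ('a \<Rightarrow> 'x) \<Rightarrow> ('a \<times> 'x) vect" where
  "post_query G f = (\<lambda>a. (\<Sum>g\<in>carrier G. tensor_vec (ket g) (ket (f g)) a)
     / of_real (sqrt (card (carrier G))))"

definition final_state ::
  "('a, 'b) monoid_scheme \<Rightarrow> 'x set \<Rightarrow> ('a \<Rightarrow> 'a \<Rightarrow> complex) \<Rightarrow> ('a \<Rightarrow> 'x) \<Rightarrow> ('a \<times> 'x) vect"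
where
  "final_state G X c f =
     apply_op (carrier G \<times> X) (tensor_op (qft G c) id_op) (post_query G f)"

definition class_state ::
  "('a, 'b) monoid_scheme \<Rightarrow> 'x set \<Rightarrow> ('a \<Rightarrow> 'a \<Rightarrow> complex) \<Rightarrow> (('a \<Rightarrow> 'x) \<Rightarrow> real) \<Rightarrow>
    ('a \<Rightarrow> 'x) set \<Rightarrow> 'a oper"
where
  "class_state G X c p A = (\<lambda>g g'. (\<Sum>f\<in>A. of_real (p f) *
     partial_trace X (ket_bra (final_state G X c f)) g g') / of_real (\<Sum>f\<in>A. p f))"

text \<open>These instantiate the notions of \<open>HOL-Probability.Information\<close> at base 2, with the
  counting measure on the range of each (discrete) random variable.\<close>

definition shannon :: "'w measure \<Rightarrow> ('w \<Rightarrow> 'b) \<Rightarrow> real" where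
  "shannon \<Omega> U = prob_space.entropy \<Omega> 2 (count_space (U ` space \<Omega>)) U"

definition cond_shannon :: "'w measure \<Rightarrow> ('w \<Rightarrow> 'b) \<Rightarrow> ('w \<Rightarrow> 'c) \<Rightarrow> real" where
  "cond_shannon \<Omega> U V = prob_space.conditional_entropy \<Omega> 2
     (count_space (U ` space \<Omega>)) (count_space (V ` space \<Omega>)) U V"

definition mutual_info :: "'w measure \<Rightarrow> ('w \<Rightarrow> 'b) \<Rightarrow> ('w \<Rightarrow> 'c) \<Rightarrow> real" where
  "mutual_info \<Omega> U V = prob_space.mutual_information \<Omega> 2
     (count_space (U ` space \<Omega>)) (count_space (V ` space \<Omega>)) U V"

end

theory Submission
  imports Defs
begin

text \<open>Tracing out the output register leaves a sum over pairs \<open>(b, b')\<close> with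
  \<open>f b = f b'\<close>, that is \<open>b = h + b'\<close> with \<open>h\<close> in the hidden subgroup \<open>K\<close>. The matrix entry
  at \<open>(g, g')\<close> therefore factors into \<open>\<Sum>h\<in>K. \<chi>\<^sub>g h\<close>, which is \<open>|K|\<close> or \<open>0\<close> according to
  whether \<open>\<chi>\<^sub>g\<close> annihilates \<open>K\<close>, and \<open>\<Sum>b'. \<chi>\<^sub>g b' * cnj (\<chi>\<^sub>g\<^sub>' b')\<close>, which vanishes off the
  diagonal. So every class state is diagonal with entries in \<open>{0, |K| / |G|}\<close>: quantum entropies
  reduce to Shannon entropies of the measured outcomes, and the conditional entropy follows from
  the outcome being uniform on its support.\<close>

section \<open>Characters of a finite abelian group\<close>

lemma character_mult:
  assumes "\<kappa> \<in> characters G" "x \<in> carrier G" "y \<in> carrier G"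
  shows "\<kappa> (x \<otimes>\<^bsub>G\<^esub> y) = \<kappa> x * \<kappa> y"
  using assms by (simp add: characters_def hom_def circle_group_def)

lemma cmod_character:
  assumes "\<kappa> \<in> characters G" "x \<in> carrier G"
  shows "cmod (\<kappa> x) = 1"
  using assms by (auto simp: characters_def hom_def circle_group_def)

lemma character_mult_cnj:
  assumes "\<kappa> \<in> characters G" "x \<in> carrier G"
  shows "\<kappa> x * cnj (\<kappa> x) = 1"
  using cmod_character[OF assms] by (simp add: complex_norm_square[symmetric])

text \<open>Translation by an \<open>h\<close> in \<open>K\<close> with \<open>\<kappa> h\<close>
  different from 1 permutes \<open>K\<close>, so the sum equals \<open>\<kappa> h\<close> times
  itself and must vanish. Only multiplicativity is asked of \<open>\<kappa>\<close>, which lets the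
  lemma apply to products such as \<open>\<kappa> x * cnj (\<mu> x)\<close>.\<close>

lemma sum_hom_subgroup:
  fixes \<kappa> :: "'a \<Rightarrow> complex"
  assumes "group G" "subgroup K G"
    and mult: "\<And>x y. x \<in> carrier G \<Longrightarrow> y \<in> carrier G \<Longrightarrow> \<kappa> (x \<otimes>\<^bsub>G\<^esub> y) = \<kappa> x * \<kappa> y"
  shows "(\<Sum>x\<in>K. \<kappa> x) = (if \<forall>h\<in>K. \<kappa> h = 1 then of_nat (card K) else 0)"
proof (cases "\<forall>h\<in>K. \<kappa> h = 1")
  case True
  then show ?thesis by simp
next
  case False
  interpret group G by fact
  interpret K: subgroup K G by fact
  obtain h where h: "h \<in> K" "\<kappa> h \<noteq> 1"
    using False by auto
  have hG: "h \<in> carrier G"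
    using h(1) K.mem_carrier by blast
  have "bij_betw (\<lambda>x. h \<otimes>\<^bsub>G\<^esub> x) K K"
    by (rule bij_betw_byWitness[where f' = "\<lambda>x. inv\<^bsub>G\<^esub> h \<otimes>\<^bsub>G\<^esub> x"])
      (use h hG in \<open>auto simp: m_assoc[symmetric] K.mem_carrier\<close>)
  then have "(\<Sum>x\<in>K. \<kappa> x) = (\<Sum>x\<in>K. \<kappa> (h \<otimes>\<^bsub>G\<^esub> x))"
    by (rule sum.reindex_bij_betw[symmetric])
  also have "\<dots> = \<kappa> h * (\<Sum>x\<in>K. \<kappa> x)"
    by (simp add: sum_distrib_left mult hG K.mem_carrier)
  finally show ?thesis
    using False h(2) by auto
qed

text \<open>This is \<open>sum_hom_subgroup\<close> on the whole group for the product of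
  \<open>\<kappa>\<close> with the conjugate of \<open>\<mu>\<close>. Since
  \<open>cnj (\<mu> x)\<close> inverts \<open>\<mu> x\<close>, that product is constantly 1 exactly
  when the characters coincide.\<close>

lemma character_orthogonality:
  assumes "group G" "\<kappa> \<in> characters G" "\<mu> \<in> characters G"
  shows "(\<Sum>x\<in>carrier G. \<kappa> x * cnj (\<mu> x)) = (if \<kappa> = \<mu> then of_nat (card (carrier G)) else 0)"
proof -
  interpret group G by fact
  have "(\<forall>x\<in>carrier G. \<kappa> x * cnj (\<mu> x) = 1) \<longleftrightarrow> \<kappa> = \<mu>"
  proof
    assume one: "\<forall>x\<in>carrier G. \<kappa> x * cnj (\<mu> x) = 1"
    have "\<kappa> x = \<mu> x" if "x \<in> carrier G" for x
      using bspec[OF one that] character_mult_cnj[OF assms(3) that]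
      by (metis mult_right_cancel mult_zero_right zero_neq_one)
    \<comment> \<open>Agreement on the carrier suffices because characters are extensional.\<close>
    with assms show "\<kappa> = \<mu>"
      by (intro extensionalityI[of _ "carrier G"]) (auto simp: characters_def)
  qed (use character_mult_cnj[OF assms(2)] in auto)
  then show ?thesis
    using sum_hom_subgroup[OF \<open>group G\<close> subgroup_self, of "\<lambda>x. \<kappa> x * cnj (\<mu> x)"]
      character_mult[OF assms(2)] character_mult[OF assms(3)]
    by simp
qed

section \<open>Characters of a product of cyclic groups\<close>

lemma exp_mod_int:
  fixes a b :: int
  assumes "n \<noteq> 0"
  shows "exp (2 * of_real pi * \<i> * of_int (a mod int n) * of_int b / of_nat n)
       = exp (2 * of_real pi * \<i> * of_int a * of_int b / of_nat n)"
proof -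
  have "(of_int a :: complex) = of_int (a mod int n) + of_nat n * of_int (a div int n)"
    by (metis mod_mult_div_eq of_int_add of_int_mult of_int_of_nat_eq)
  \<comment> \<open>The exponents differ by an integer multiple of 2 pi i, written in the shape that
    \<open>exp_eq\<close> expects.\<close>
  then have "2 * of_real pi * \<i> * of_int (a mod int n) * of_int b / of_nat n
     = 2 * of_real pi * \<i> * of_int a * of_int b / of_nat n + (of_int (2 * (- (a div int n) * b)) * pi) * \<i>"
    using assms by (simp add: field_simps)
  then show ?thesis
    unfolding exp_eq by blast
qed

lemma carrier_cyclic_product:
  assumes "\<forall>i\<in>{1..M}. d i \<ge> 1"
  shows "carrier (cyclic_product M d) = (\<Pi>\<^sub>E i\<in>{1..M}. {0..<int (d i)})"
  unfolding cyclic_product_def carrier_product_group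
  by (rule PiE_cong) (use assms in \<open>force simp: carrier_integer_mod_group\<close>)

lemma mult_cyclic_product:
  "x \<otimes>\<^bsub>cyclic_product M d\<^esub> y = (\<lambda>i\<in>{1..M}. (x i + y i) mod int (d i))"
  by (simp add: cyclic_product_def)

lemma group_cyclic_product: "group (cyclic_product M d)"
  by (simp add: cyclic_product_def)

text \<open>This is \<open>k\<close> times the \<open>i\<close>-th generator. For positive moduli
  the reduction keeps it in the carrier for every integer \<open>k\<close>, even for
  \<open>k = 1\<close> when \<open>d i = 1\<close>; for \<open>i\<close> outside
  \<open>{1..M}\<close> it is the identity.\<close>

definition coordinate_element :: "nat \<Rightarrow> (nat \<Rightarrow> nat) \<Rightarrow> nat \<Rightarrow> int \<Rightarrow> nat \<Rightarrow> int" where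
  "coordinate_element M d i k = (\<lambda>j\<in>{1..M}. if j = i then k mod int (d i) else 0)"

lemma coordinate_element_carrier:
  assumes "\<forall>i\<in>{1..M}. d i \<ge> 1"
  shows "coordinate_element M d i k \<in> carrier (cyclic_product M d)"
proof -
  have "0 \<le> k mod int (d i) \<and> k mod int (d i) < int (d i)" "0 < d i" if "i \<in> {1..M}" for i
    using bspec[OF assms that] by auto
  then show ?thesis
    by (auto simp: carrier_cyclic_product[OF assms] coordinate_element_def)
qed

lemma coordinate_element_add:
  "coordinate_element M d i a \<otimes>\<^bsub>cyclic_product M d\<^esub> coordinate_element M d i b
     = coordinate_element M d i (a + b)"
  by (auto simp: mult_cyclic_product coordinate_element_def mod_add_eq)

lemma coordinate_element_0: "coordinate_element M d i 0 = \<one>\<^bsub>cyclic_product M d\<^esub>"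
  by (auto simp: coordinate_element_def cyclic_product_def)

lemma hom_coordinate_element:
  fixes \<theta> :: "(nat \<Rightarrow> int) \<Rightarrow> complex"
  assumes d: "\<forall>i\<in>{1..M}. d i \<ge> 1"
    and \<theta>: "\<theta> \<in> hom (cyclic_product M d) circle_group"
  shows "\<theta> (coordinate_element M d i (int k)) = \<theta> (coordinate_element M d i 1) ^ k"
proof (induction k)
  case 0
  \<comment> \<open>At 0 the value is idempotent and has modulus 1, hence equals 1.\<close>
  have "\<theta> (coordinate_element M d i 0) * \<theta> (coordinate_element M d i 0) = \<theta> (coordinate_element M d i 0)"
    and "cmod (\<theta> (coordinate_element M d i 0)) = 1"
    using \<theta> coordinate_element_carrier[OF d, of i 0] coordinate_element_add[of M d i 0 0]
    by (fastforce simp: hom_def circle_group_def Pi_iff)+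
  then show ?case by auto
next
  case (Suc k)
  have "\<theta> (coordinate_element M d i (int (Suc k)))
      = \<theta> (coordinate_element M d i 1 \<otimes>\<^bsub>cyclic_product M d\<^esub> coordinate_element M d i (int k))"
    by (simp add: coordinate_element_add)
  then show ?case
    using \<theta> coordinate_element_carrier[OF d] Suc by (simp add: hom_def circle_group_def)
qed

text \<open>The element \<open>l\<close> is the sum of its coordinates times the generators, so a
  homomorphism is determined by its values on the generators.\<close>

lemma hom_cyclic_product_eq_prod:
  fixes \<theta> :: "(nat \<Rightarrow> int) \<Rightarrow> complex"
  assumes d: "\<forall>i\<in>{1..M}. d i \<ge> 1"
    and \<theta>: "\<theta> \<in> hom (cyclic_product M d) circle_group"
    and l: "l \<in> carrier (cyclic_product M d)"
  shows "\<theta> l = (\<Prod>i=1..M. \<theta> (coordinate_element M d i 1) ^ nat (l i))"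
proof -
  let ?P = "cyclic_product M d" and ?E = "coordinate_element M d"
  note E = coordinate_element_carrier[OF d]
  have l_bounds: "0 \<le> l i" "l i < int (d i)" if "i \<in> {1..M}" for i
    using l that by (auto simp: carrier_cyclic_product[OF d])
  have mult: "\<theta> (x \<otimes>\<^bsub>?P\<^esub> y) = \<theta> x * \<theta> y" if "x \<in> carrier ?P" "y \<in> carrier ?P" for x y
    using \<theta> that by (simp add: hom_def circle_group_def)
  note power = hom_coordinate_element[OF d \<theta>]
  have one: "\<theta> \<one>\<^bsub>?P\<^esub> = 1"
    using power[of _ 0] by (simp add: coordinate_element_0)
  \<comment> \<open>The induction runs over truncations of \<open>l\<close> to its first
    \<open>m\<close> coordinates; each step adds one multiple of a generator.\<close>
  have "\<theta> (\<lambda>j\<in>{1..M}. if j \<le> m then l j else 0) = (\<Prod>i=1..m. \<theta> (?E i (l i)))" if "m \<le> M" for m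
    using that
  proof (induction m)
    case 0
    have "(\<lambda>j\<in>{1..M}. if j \<le> 0 then l j else 0) = \<one>\<^bsub>?P\<^esub>"
      by (auto simp: cyclic_product_def)
    then show ?case using one by simp
  next
    case (Suc m)
    let ?r = "\<lambda>j\<in>{1..M}. if j \<le> m then l j else 0"
    have "?r \<in> carrier ?P"
      using l by (auto simp: carrier_cyclic_product[OF d] PiE_iff)
    moreover have "(\<lambda>j\<in>{1..M}. if j \<le> Suc m then l j else 0) = ?r \<otimes>\<^bsub>?P\<^esub> ?E (Suc m) (l (Suc m))"
      using l_bounds by (auto simp: mult_cyclic_product coordinate_element_def fun_eq_iff le_Suc_eq)
    moreover have "\<theta> ?r = (\<Prod>i=1..m. \<theta> (?E i (l i)))"
      using Suc.prems by (intro Suc.IH) simp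
    ultimately show ?case
      by (simp only: mult E) simp
  qed
  from this[of M] have "\<theta> (\<lambda>j\<in>{1..M}. if j \<le> M then l j else 0) = (\<Prod>i=1..M. \<theta> (?E i (l i)))"
    by simp
  also have "(\<lambda>j\<in>{1..M}. if j \<le> M then l j else 0) = l"
    using l by (auto simp: carrier_cyclic_product[OF d] PiE_iff extensional_def)
  also have "(\<Prod>i=1..M. \<theta> (?E i (l i))) = (\<Prod>i=1..M. \<theta> (?E i 1) ^ nat (l i))"
    by (rule prod.cong) (use l_bounds power in \<open>auto simp flip: power\<close>)
  finally show ?thesis .
qed

text \<open>Since \<open>d i\<close> times the generator is the identity, its value is a root of
  unity. This provides the exponents in the surjectivity part of
  \<open>bij_betw_chi\<close>.\<close>

lemma hom_coordinate_element_power: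
  fixes \<theta> :: "(nat \<Rightarrow> int) \<Rightarrow> complex"
  assumes d: "\<forall>i\<in>{1..M}. d i \<ge> 1"
    and \<theta>: "\<theta> \<in> hom (cyclic_product M d) circle_group"
  shows "\<theta> (coordinate_element M d i 1) ^ d i = 1"
proof -
  have "coordinate_element M d i (int (d i)) = coordinate_element M d i 0"
    by (auto simp: coordinate_element_def)
  then show ?thesis
    using hom_coordinate_element[OF d \<theta>, of i "d i"] hom_coordinate_element[OF d \<theta>, of i 0] by simp
qed

text \<open>The group law reduces each coordinate modulo \<open>d i\<close>, and by
  \<open>exp_mod_int\<close> the exponential does not see that reduction.\<close>

lemma chi_character:
  assumes d: "\<forall>i\<in>{1..M}. d i \<ge> 1"
    and \<phi>: "\<phi> \<in> hom G (cyclic_product M d)" and "group G"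
  shows "chi G M d \<phi> g \<in> characters G"
proof -
  interpret group G by fact
  let ?e = "\<lambda>l i. exp (2 * of_real pi * \<i> * of_int (l i) * of_int (\<phi> g i) / of_nat (d i))"
  have norm: "cmod (?e l i) = 1" for l :: "nat \<Rightarrow> int" and i
    by (simp add: norm_exp_eq_Re)
  have "(\<Prod>i=1..M. ?e (\<phi> (x \<otimes>\<^bsub>G\<^esub> y)) i) = (\<Prod>i=1..M. ?e (\<phi> x) i) * (\<Prod>i=1..M. ?e (\<phi> y) i)"
    if "x \<in> carrier G" "y \<in> carrier G" for x y
  proof -
    have "\<phi> (x \<otimes>\<^bsub>G\<^esub> y) = (\<lambda>i\<in>{1..M}. (\<phi> x i + \<phi> y i) mod int (d i))"
      using \<phi> that by (simp add: hom_def mult_cyclic_product)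
    then have "?e (\<phi> (x \<otimes>\<^bsub>G\<^esub> y)) i = ?e (\<phi> x) i * ?e (\<phi> y) i" if "i \<in> {1..M}" for i
      using that bspec[OF d that] exp_mod_int[of "d i" "\<phi> x i + \<phi> y i" "\<phi> g i"]
      by (simp add: exp_add[symmetric] add_divide_distrib distrib_left distrib_right)
    then show ?thesis
      by (simp add: prod.distrib[symmetric])
  qed
  then show ?thesis
    by (auto simp: characters_def chi_def hom_def circle_group_def norm prod_norm[symmetric])
qed

text \<open>Both halves evaluate characters at the generators: the values of
  \<open>chi G M d \<phi> g\<close> there recover the coordinates of \<open>g\<close>, and the
  values of an arbitrary character there are roots of unity whose exponents form the coordinates of
  a preimage.\<close>

lemma bij_betw_chi:
  assumes d: "\<forall>i\<in>{1..M}. d i \<ge> 1"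
    and \<phi>: "\<phi> \<in> iso G (cyclic_product M d)" and "group G"
  shows "bij_betw (chi G M d \<phi>) (carrier G) (characters G)"
proof -
  interpret group G by fact
  let ?P = "cyclic_product M d" and ?E = "coordinate_element M d"
  let ?u = "\<lambda>i k. exp (2 * of_real pi * \<i> * of_nat k / of_nat (d i)) :: complex"
  define \<psi> where "\<psi> = inv_into (carrier G) \<phi>"
  have \<phi>_hom: "\<phi> \<in> hom G ?P" and \<phi>_bij: "bij_betw \<phi> (carrier G) (carrier ?P)"
    using \<phi> by (auto simp: iso_def)
  have \<psi>: "\<psi> \<in> hom ?P G"
    using iso_set_sym[OF \<phi>] by (simp add: \<psi>_def iso_def)
  have \<psi>_carrier: "\<psi> l \<in> carrier G" and \<phi>_\<psi>: "\<phi> (\<psi> l) = l" if "l \<in> carrier ?P" for l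
    using that \<psi> bij_betw_inv_into_right[OF \<phi>_bij that] by (auto simp: hom_def \<psi>_def)
  have \<psi>_\<phi>: "\<psi> (\<phi> g) = g" if "g \<in> carrier G" for g
    using that by (simp add: \<psi>_def bij_betw_inv_into_left[OF \<phi>_bij])
  have \<phi>_carrier: "\<phi> g \<in> carrier ?P" if "g \<in> carrier G" for g
    using that \<phi>_hom by (auto simp: hom_def)
  have bounds: "0 \<le> \<phi> g i" "\<phi> g i < int (d i)" if "g \<in> carrier G" "i \<in> {1..M}" for g i
    using \<phi>_carrier[OF that(1)] that(2) by (auto simp: carrier_cyclic_product[OF d])
  have chi_coordinate: "chi G M d \<phi> g (\<psi> (?E i 1)) = ?u i (nat (\<phi> g i))"
    if "g \<in> carrier G" "i \<in> {1..M}" for g i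
  proof -
    have E: "?E i 1 \<in> carrier ?P"
      by (rule coordinate_element_carrier[OF d])
    have "chi G M d \<phi> g (\<psi> (?E i 1)) =
        (\<Prod>j=1..M. exp (2 * of_real pi * \<i> * of_int (?E i 1 j) * of_int (\<phi> g j) / of_nat (d j)))"
      by (simp add: chi_def \<psi>_carrier[OF E] \<phi>_\<psi>[OF E])
    also have "\<dots> = (\<Prod>j=1..M. if j = i then ?u i (nat (\<phi> g i)) else 1)"
    proof (rule prod.cong, goal_cases)
      case (2 j)
      \<comment> \<open>If \<open>d i = 1\<close>, the coordinate of the generator is 0 instead of
        1; \<open>exp_mod_int\<close> treats this case along with the others.\<close>
      show ?case
        using 2 bspec[OF d 2] bounds[OF that(1) 2] exp_mod_int[of "d i" 1 "\<phi> g i"]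
        by (cases "j = i") (auto simp: coordinate_element_def)
    qed simp
    also have "\<dots> = ?u i (nat (\<phi> g i))"
      using that by simp
    finally show ?thesis .
  qed
  have "inj_on (chi G M d \<phi>) (carrier G)"
  proof (rule inj_onI)
    fix g g' assume g: "g \<in> carrier G" "g' \<in> carrier G" and eq: "chi G M d \<phi> g = chi G M d \<phi> g'"
    have "\<phi> g i = \<phi> g' i" if i: "i \<in> {1..M}" for i
    proof -
      \<comment> \<open>Equal roots of unity have congruent exponents, and both coordinates already
        lie below \<open>d i\<close>.\<close>
      have "nat (\<phi> g i) mod d i = nat (\<phi> g' i) mod d i"
        using chi_coordinate[OF g(1) i] chi_coordinate[OF g(2) i] eq complex_root_unity_eq[OF bspec[OF d i]]
        by metis
      then show ?thesis
        using bounds[OF g(1) i] bounds[OF g(2) i] by (simp add: mod_less nat_less_iff)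
    qed
    then have "\<phi> g = \<phi> g'"
      using \<phi>_carrier[OF g(1)] \<phi>_carrier[OF g(2)]
      by (intro extensionalityI[of _ "{1..M}"]) (auto simp: carrier_cyclic_product[OF d] PiE_iff)
    then show "g = g'"
      using g \<psi>_\<phi> by metis
  qed
  moreover have "chi G M d \<phi> ` carrier G = characters G"
  proof
    show "chi G M d \<phi> ` carrier G \<subseteq> characters G"
      using chi_character[OF d \<phi>_hom \<open>group G\<close>] by auto
    show "characters G \<subseteq> chi G M d \<phi> ` carrier G"
    proof
      fix \<kappa> assume \<kappa>: "\<kappa> \<in> characters G"
      then have \<theta>: "\<kappa> \<circ> \<psi> \<in> hom ?P circle_group"
        using \<psi> by (auto simp: characters_def hom_def Pi_iff)
      have "\<exists>k. k < d i \<and> (\<kappa> \<circ> \<psi>) (?E i 1) = ?u i k" if "i \<in> {1..M}" for i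
        using complex_roots_unity[OF bspec[OF d that]] hom_coordinate_element_power[OF d \<theta>, of i] by auto
      then obtain k where k: "\<And>i. i \<in> {1..M} \<Longrightarrow> k i < d i \<and> (\<kappa> \<circ> \<psi>) (?E i 1) = ?u i (k i)"
        by metis
      \<comment> \<open>The exponents of the values on the generators are the coordinates of the
        preimage.\<close>
      define \<gamma> where "\<gamma> = (\<lambda>i\<in>{1..M}. int (k i))"
      have \<gamma>: "\<gamma> \<in> carrier ?P"
        using k by (auto simp: \<gamma>_def carrier_cyclic_product[OF d])
      have "\<kappa> l = chi G M d \<phi> (\<psi> \<gamma>) l" if l: "l \<in> carrier G" for l
      proof -
        have "\<kappa> l = (\<kappa> \<circ> \<psi>) (\<phi> l)"
          by (simp add: \<psi>_\<phi> l)
        also have "\<dots> = (\<Prod>i=1..M. (\<kappa> \<circ> \<psi>) (?E i 1) ^ nat (\<phi> l i))"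
          by (rule hom_cyclic_product_eq_prod[OF d \<theta> \<phi>_carrier[OF l]])
        also have "\<dots> = (\<Prod>i=1..M. exp (2 * of_real pi * \<i> * of_int (\<phi> l i) * of_int (\<gamma> i) / of_nat (d i)))"
        proof (rule prod.cong)
          fix i assume i: "i \<in> {1..M}"
          have "(\<kappa> \<circ> \<psi>) (?E i 1) ^ nat (\<phi> l i) = exp (of_nat (nat (\<phi> l i)) * (2 * of_real pi * \<i> * of_nat (k i) / of_nat (d i)))"
            unfolding exp_of_nat_mult using k[OF i] by simp
          also have "(of_nat (nat (\<phi> l i)) :: complex) = of_int (\<phi> l i)"
            using bounds[OF l i] by simp
          finally show "(\<kappa> \<circ> \<psi>) (?E i 1) ^ nat (\<phi> l i)
              = exp (2 * of_real pi * \<i> * of_int (\<phi> l i) * of_int (\<gamma> i) / of_nat (d i))"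
            using i by (simp add: \<gamma>_def mult_ac)
        qed simp
        also have "\<dots> = chi G M d \<phi> (\<psi> \<gamma>) l"
          using l by (simp add: chi_def \<phi>_\<psi>[OF \<gamma>])
        finally show ?thesis .
      qed
      then have "\<kappa> = chi G M d \<phi> (\<psi> \<gamma>)"
        using \<kappa> by (intro extensionalityI[of _ "carrier G"]) (auto simp: characters_def chi_def)
      then show "\<kappa> \<in> chi G M d \<phi> ` carrier G"
        using \<psi>_carrier[OF \<gamma>] by blast
    qed
  qed
  ultimately show ?thesis
    by (simp add: bij_betw_def)
qed

section \<open>The state of the input register\<close>

lemma post_query_eq:
  assumes "finite (carrier G)"
  shows "post_query G f (b, y) =
    (if b \<in> carrier G \<and> f b = y then 1 / of_real (sqrt (card (carrier G))) else 0)"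
proof -
  have "(\<Sum>g\<in>carrier G. tensor_vec (ket g) (ket (f g)) (b, y))
      = (\<Sum>g\<in>carrier G. if g = b then (if f b = y then 1 else 0) else 0)"
    by (rule sum.cong) (auto simp: tensor_vec_def ket_def)
  then show ?thesis
    using assms by (simp add: post_query_def sum.delta)
qed

text \<open>The identity on the output register keeps \<open>x\<close>, so only the fibre of
  \<open>f\<close> over \<open>x\<close> contributes. The query state and the transform each supply
  a factor 1/sqrt|G|.\<close>

lemma final_state_eq:
  assumes fin: "finite (carrier G)" and f: "f \<in> carrier G \<rightarrow> X"
  shows "final_state G X c f (g, x) =
    (\<Sum>b | b \<in> carrier G \<and> f b = x. c g b) / of_nat (card (carrier G))"
proof -
  let ?s = "complex_of_real (sqrt (card (carrier G)))"
  let ?S = "{b \<in> carrier G. f b = x}"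
  have s: "?s * ?s = of_nat (card (carrier G))"
    by (simp flip: of_real_mult)
  have "final_state G X c f (g, x) =
      (\<Sum>\<^sub>\<infinity>a\<in>carrier G \<times> X. tensor_op (qft G c) id_op (g, x) a * post_query G f a)"
    by (simp add: final_state_def apply_op_def)
  \<comment> \<open>All other terms vanish, and \<open>f\<close> maps into \<open>X\<close>, so
    these labels do occur; the sum is now finite.\<close>
  also have "\<dots> = (\<Sum>\<^sub>\<infinity>a\<in>(\<lambda>b. (b, x)) ` ?S. c g (fst a) / ?s / ?s)"
    by (rule infsum_cong_neutral)
      (use f in \<open>auto simp: tensor_op_def id_op_def post_query_eq[OF fin] qft_def split: if_splits\<close>)
  also have "\<dots> = (\<Sum>b\<in>?S. c g b / ?s / ?s)"
    using fin by (simp add: sum.reindex inj_on_def)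
  also have "\<dots> = (\<Sum>b\<in>?S. c g b) / of_nat (card (carrier G))"
    by (simp add: sum_divide_distrib s)
  finally show ?thesis .
qed

lemma partial_trace_final_state:
  assumes "group G" and fin: "finite (carrier G)" and f: "f \<in> carrier G \<rightarrow> X"
    and hides: "hides G f K"
    and c: "c g \<in> characters G" "c g' \<in> characters G" and inj: "c g = c g' \<longleftrightarrow> g = g'"
  shows "partial_trace X (ket_bra (final_state G X c f)) g g' =
    (if g = g' \<and> c g \<in> annihilator G K then of_nat (card K) / of_nat (card (carrier G)) else 0)"
proof -
  interpret group G by fact
  interpret K: subgroup K G
    using hides by (simp add: hides_def)
  let ?n = "of_nat (card (carrier G)) :: complex"
  let ?S = "\<lambda>x. {b \<in> carrier G. f b = x}"
  have n: "?n \<noteq> 0"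
    using fin by auto
  \<comment> \<open>Because \<open>f\<close> hides \<open>K\<close>, its fibre through
    \<open>b'\<close> is the coset of \<open>K\<close> containing \<open>b'\<close>.\<close>
  have fibre: "(\<Sum>b\<in>?S (f b'). c g b) = (\<Sum>h\<in>K. c g h) * c g b'" if b': "b' \<in> carrier G" for b'
  proof -
    have "bij_betw (\<lambda>h. h \<otimes>\<^bsub>G\<^esub> b') K (?S (f b'))"
    proof (rule bij_betw_byWitness[where f' = "\<lambda>b. b \<otimes>\<^bsub>G\<^esub> inv\<^bsub>G\<^esub> b'"])
      show "(\<lambda>h. h \<otimes>\<^bsub>G\<^esub> b') ` K \<subseteq> ?S (f b')"
        using hides b' by (auto simp: hides_def m_assoc K.mem_carrier)
      show "(\<lambda>b. b \<otimes>\<^bsub>G\<^esub> inv\<^bsub>G\<^esub> b') ` ?S (f b') \<subseteq> K"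
        using hides b' by (auto simp: hides_def)
    qed (use b' in \<open>auto simp: m_assoc K.mem_carrier\<close>)
    then have "(\<Sum>b\<in>?S (f b'). c g b) = (\<Sum>h\<in>K. c g (h \<otimes>\<^bsub>G\<^esub> b'))"
      by (rule sum.reindex_bij_betw[symmetric])
    then show ?thesis
      using b' by (simp add: character_mult[OF c(1)] K.mem_carrier sum_distrib_right)
  qed
  have "partial_trace X (ket_bra (final_state G X c f)) g g' =
      (\<Sum>\<^sub>\<infinity>x\<in>X. (\<Sum>b\<in>?S x. c g b) / ?n * cnj ((\<Sum>b\<in>?S x. c g' b) / ?n))"
    by (simp add: partial_trace_def ket_bra_def final_state_eq[OF fin f])
  \<comment> \<open>Values not attained by \<open>f\<close> have an empty fibre, so a finite sum
    remains even for infinite \<open>X\<close>.\<close>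
  also have "\<dots> = (\<Sum>\<^sub>\<infinity>x\<in>f ` carrier G. (\<Sum>b\<in>?S x. c g b) / ?n * cnj ((\<Sum>b\<in>?S x. c g' b) / ?n))"
  proof (rule infsum_cong_neutral)
    fix x assume "x \<in> X - f ` carrier G"
    then have "?S x = {}" by auto
    then show "(\<Sum>b\<in>?S x. c g b) / ?n * cnj ((\<Sum>b\<in>?S x. c g' b) / ?n) = 0"
      by (simp only: sum.empty) simp
  qed (use f in auto)
  \<comment> \<open>Writing \<open>f b'\<close> for \<open>x\<close> in the first factor removes the
    dependence on \<open>x\<close>, so that the sums over values and over fibres merge into one over
    the carrier.\<close>
  also have "\<dots> = (\<Sum>x\<in>f ` carrier G. \<Sum>b'\<in>?S x. (\<Sum>b\<in>?S (f b'). c g b) * cnj (c g' b')) / ?n^2"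
  proof -
    have "(\<Sum>b\<in>?S x. c g b) / ?n * cnj ((\<Sum>b\<in>?S x. c g' b) / ?n)
        = (\<Sum>b'\<in>?S x. (\<Sum>b\<in>?S (f b'). c g b) * cnj (c g' b')) / ?n^2" for x
    proof -
      have "(\<Sum>b'\<in>?S x. (\<Sum>b\<in>?S (f b'). c g b) * cnj (c g' b'))
          = (\<Sum>b'\<in>?S x. (\<Sum>b\<in>?S x. c g b) * cnj (c g' b'))"
        by (rule sum.cong) auto
      then show ?thesis
        by (simp add: sum_distrib_left[symmetric] power2_eq_square)
    qed
    then show ?thesis
      using fin by (simp add: sum_divide_distrib)
  qed
  also have "\<dots> = (\<Sum>b'\<in>carrier G. (\<Sum>b\<in>?S (f b'). c g b) * cnj (c g' b')) / ?n^2"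
    by (rule arg_cong[where f = "\<lambda>z. z / _"], rule sum.image_gen[OF fin, symmetric])
  also have "\<dots> = (\<Sum>h\<in>K. c g h) * (\<Sum>b'\<in>carrier G. c g b' * cnj (c g' b')) / ?n^2"
    by (simp add: fibre sum_distrib_left mult.assoc)
  also have "(\<Sum>h\<in>K. c g h) = (if \<forall>h\<in>K. c g h = 1 then of_nat (card K) else 0)"
    by (rule sum_hom_subgroup[OF is_group K.subgroup_axioms]) (rule character_mult[OF c(1)])
  \<comment> \<open>Orthogonality gives |G| on the diagonal and 0 elsewhere; \<open>inj\<close>
    turns equality of characters into equality of labels.\<close>
  also have "\<dots> * (\<Sum>b'\<in>carrier G. c g b' * cnj (c g' b')) / ?n^2
      = (if g = g' \<and> (\<forall>h\<in>K. c g h = 1) then of_nat (card K) / ?n else 0)"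
    unfolding character_orthogonality[OF is_group c] inj
    using n by (auto simp: power2_eq_square)
  finally show ?thesis
    using c(1) by (simp add: annihilator_def)
qed

text \<open>A hidden subgroup is the level set of \<open>f\<close> through the identity, hence is
  determined by \<open>f\<close>.\<close>

lemma hides_unique:
  assumes "group G" "hides G f K" "hides G f L"
  shows "K = L"
proof -
  interpret group G by fact
  have "K' = {g \<in> carrier G. f g = f \<one>\<^bsub>G\<^esub>}" if "hides G f K'" for K'
    using that subgroup.subset[of K' G] by (auto simp: hides_def)
  then show ?thesis
    using assms by metis
qed

text \<open>The reduced state depends on \<open>f\<close> only through the hidden subgroup, so
  averaging over a class leaves it unchanged.\<close>

lemma class_state_eq:
  assumes "group G" "finite (carrier G)"
    and "\<And>f. f \<in> A \<Longrightarrow> f \<in> carrier G \<rightarrow> X \<and> hides G f K"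
    and "c g \<in> characters G" "c g' \<in> characters G" "c g = c g' \<longleftrightarrow> g = g'"
    and p: "(\<Sum>f\<in>A. p f) \<noteq> 0"
  shows "class_state G X c p A g g' =
    (if g = g' \<and> c g \<in> annihilator G K then of_nat (card K) / of_nat (card (carrier G)) else 0)"
proof -
  define w :: complex where "w =
    (if g = g' \<and> c g \<in> annihilator G K then of_nat (card K) / of_nat (card (carrier G)) else 0)"
  have "partial_trace X (ket_bra (final_state G X c f)) g g' = w" if "f \<in> A" for f
    unfolding w_def using assms(3)[OF that] by (intro partial_trace_final_state assms) auto
  then have "class_state G X c p A g g' = (\<Sum>f\<in>A. of_real (p f) * w) / of_real (\<Sum>f\<in>A. p f)"
    by (simp add: class_state_def)
  also have "\<dots> = of_real (\<Sum>f\<in>A. p f) * w / of_real (\<Sum>f\<in>A. p f)"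
    by (simp add: sum_distrib_right)
  also have "\<dots> = w"
    using p by (simp del: of_real_sum)
  finally show ?thesis
    by (simp only: w_def)
qed

section \<open>Tensor powers, mixtures and spectra of diagonal operators\<close>

lemma tensor_power_diagonal:
  assumes "diagonal_on B A"
  shows "diagonal_on (tuples t B) (tensor_power t A)"
  unfolding diagonal_on_def
proof (intro ballI impI)
  fix a b assume ab: "a \<in> tuples t B" "b \<in> tuples t B" "a \<noteq> b"
  \<comment> \<open>Distinct tuples differ in some coordinate, which contributes a zero factor to
    the product.\<close>
  then obtain i where "i \<in> {1..t}" "a i \<noteq> b i"
    unfolding tuples_def by (metis PiE_ext)
  moreover from this have "a i \<in> B" "b i \<in> B"
    using ab by (auto simp: tuples_def)
  ultimately have "i \<in> {1..t}" "A (a i) (b i) = 0"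
    using assms by (auto simp: diagonal_on_def)
  then show "tensor_power t A a b = 0"
    by (auto simp: tensor_power_def intro!: prod_zero)
qed

lemma mixture_diagonal:
  assumes "\<And>j. j \<in> \<J> \<Longrightarrow> diagonal_on B (R j)"
  shows "diagonal_on B (mixture \<J> q R)"
  using assms by (simp add: diagonal_on_def mixture_def)

lemma bij_betw_tuples:
  assumes "bij_betw f B C"
  shows "bij_betw (\<lambda>a. \<lambda>i\<in>{1..t}. f (a i)) (tuples t B) (tuples t C)"
proof (rule bij_betw_byWitness[where f' = "\<lambda>a. \<lambda>i\<in>{1..t}. inv_into B f (a i)"])
  show "\<forall>a\<in>tuples t B. (\<lambda>i\<in>{1..t}. inv_into B f ((\<lambda>i\<in>{1..t}. f (a i)) i)) = a"
    using bij_betw_inv_into_left[OF assms]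
    by (auto simp: tuples_def PiE_iff extensional_def fun_eq_iff)
  show "\<forall>a\<in>tuples t C. (\<lambda>i\<in>{1..t}. f ((\<lambda>i\<in>{1..t}. inv_into B f (a i)) i)) = a"
    using bij_betw_inv_into_right[OF assms]
    by (auto simp: tuples_def PiE_iff extensional_def fun_eq_iff)
  show "(\<lambda>a. \<lambda>i\<in>{1..t}. f (a i)) ` tuples t B \<subseteq> tuples t C"
    using bij_betwE[OF assms] by (auto simp: tuples_def)
  show "(\<lambda>a. \<lambda>i\<in>{1..t}. inv_into B f (a i)) ` tuples t C \<subseteq> tuples t B"
    using bij_betwE[OF bij_betw_inv_into[OF assms]] by (auto simp: tuples_def)
qed

lemma finite_tuples: "finite B \<Longrightarrow> finite (tuples t B)"
  by (simp add: tuples_def finite_PiE)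

text \<open>Under any enumeration of \<open>B\<close> the matrix is triangular, so its
  characteristic polynomial splits into linear factors given by the diagonal. The enumeration is a
  bijection, so passing back to labels preserves multiplicities.\<close>

lemma eigenvalues_diagonal:
  assumes fin: "finite B" and diag: "diagonal_on B A"
  shows "eigenvalues B A = image_mset (\<lambda>a. A a a) (mset_set B)"
proof -
  let ?n = "card B" and ?e = "from_nat_into B"
  have bij: "bij_betw ?e {..<?n} B"
    by (rule bij_betw_from_nat_into_finite[OF fin])
  have "matrix_on B A \<in> carrier_mat ?n ?n"
    by (simp add: matrix_on_def)
  moreover have "upper_triangular (matrix_on B A)"
  proof (rule upper_triangularI)
    fix i j assume "j < i" "i < dim_row (matrix_on B A)"
    moreover from this have "?e i \<noteq> ?e j" "?e i \<in> B" "?e j \<in> B"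
      using bij_betwE[OF bij] inj_onD[OF bij_betw_imp_inj_on[OF bij], of i j]
      by (auto simp: matrix_on_def)
    ultimately show "matrix_on B A $$ (i, j) = 0"
      using diag by (auto simp: matrix_on_def diagonal_on_def)
  qed
  ultimately have "char_poly (matrix_on B A) = (\<Prod>a\<leftarrow>diag_mat (matrix_on B A). [:- a, 1:])"
    by (rule char_poly_upper_triangular)
  also have "diag_mat (matrix_on B A) = map (\<lambda>k. A (?e k) (?e k)) [0..<?n]"
    by (auto simp: diag_mat_def matrix_on_def)
  finally have "eigenvalues B A = (\<Sum>p\<leftarrow>map (\<lambda>k. [:- A (?e k) (?e k), 1:]) [0..<?n]. proots p)"
    unfolding eigenvalues_def by (subst proots_prod_list[symmetric]) (auto simp: o_def)
  also have "\<dots> = image_mset (\<lambda>k. A (?e k) (?e k)) (mset_set {..<?n})"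
    by (simp add: o_def interv_sum_list_conv_sum_set_nat atLeast0LessThan)
  also have "\<dots> = image_mset (\<lambda>a. A a a) (image_mset ?e (mset_set {..<?n}))"
    by (simp add: image_mset.compositionality o_def)
  also have "\<dots> = image_mset (\<lambda>a. A a a) (mset_set B)"
    using bij by (simp add: image_mset_mset_set bij_betw_def)
  finally show ?thesis .
qed

lemma von_neumann_entropy_diagonal:
  assumes "finite B" "diagonal_on B A"
  shows "von_neumann_entropy B A = - (\<Sum>a\<in>B. Re (A a a) * log 2 (Re (A a a)))"
  by (simp add: von_neumann_entropy_def eigenvalues_diagonal[OF assms] sum_unfold_sum_mset
    image_mset.compositionality o_def)

section \<open>Entropies of finitely supported random variables\<close>

context prob_space
begin

lemma simple_function_count_space:
  assumes "U \<in> measurable M (count_space S)" "finite S"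
  shows "simple_function M U"
proof -
  have "U ` space M \<subseteq> S"
    using assms(1) by (auto simp: measurable_count_space_eq2[OF assms(2)])
  then show ?thesis
    using assms measurable_sets[OF assms(1), of "{_}"]
    by (auto simp: simple_function_def finite_subset)
qed

lemma simple_distributed_prob:
  assumes "simple_function M U"
  shows "simple_distributed M U (\<lambda>u. prob (U -` {u} \<inter> space M))"
  using assms by (rule simple_distributedI) auto

lemma prob_vimage_outside:
  assumes "u \<notin> U ` space M"
  shows "prob (U -` {u} \<inter> space M) = 0"
proof -
  have "U -` {u} \<inter> space M = {}" using assms by auto
  then show ?thesis by simp
qed

text \<open>The entropy is defined over the range of \<open>U\<close>; enlarging the range to
  \<open>S\<close> only adds terms of probability 0.\<close>

lemma shannon_eq_sum:
  assumes U: "U \<in> measurable M (count_space S)" and fin: "finite S"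
  shows "shannon M U = - (\<Sum>u\<in>S. prob (U -` {u} \<inter> space M) * log 2 (prob (U -` {u} \<inter> space M)))"
proof -
  interpret information_space M 2
    by unfold_locales simp
  have "U ` space M \<subseteq> S"
    using U by (auto simp: measurable_count_space_eq2[OF fin])
  then have "(\<Sum>u\<in>U ` space M. prob (U -` {u} \<inter> space M) * log 2 (prob (U -` {u} \<inter> space M)))
      = (\<Sum>u\<in>S. prob (U -` {u} \<inter> space M) * log 2 (prob (U -` {u} \<inter> space M)))"
    by (rule sum.mono_neutral_left[OF fin]) (auto simp: prob_vimage_outside)
  then show ?thesis
    unfolding shannon_def
    by (simp add: entropy_simple_distributed[OF simple_distributed_prob[OF simple_function_count_space[OF U fin]]])
qed

text \<open>Unattained pairs have joint probability 0, so the sum may run over all of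
  \<open>S \<times> T\<close>; the quotient inside the logarithm is the conditional
  probability.\<close>

lemma cond_shannon_eq_sum:
  assumes U: "U \<in> measurable M (count_space S)" "finite S"
    and V: "V \<in> measurable M (count_space T)" "finite T"
  shows "cond_shannon M U V = - (\<Sum>v\<in>T. \<Sum>u\<in>S. \<P>(\<omega> in M. U \<omega> = u \<and> V \<omega> = v)
      * log 2 (\<P>(\<omega> in M. U \<omega> = u \<bar> V \<omega> = v)))"
proof -
  interpret information_space M 2
    by unfold_locales simp
  let ?W = "\<lambda>\<omega>. (U \<omega>, V \<omega>)"
  let ?P = "\<lambda>w. prob (?W -` {w} \<inter> space M)"
  let ?h = "\<lambda>w. ?P w * log 2 (?P w / prob (V -` {snd w} \<inter> space M))"
  note sU = simple_function_count_space[OF U] and sV = simple_function_count_space[OF V]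
  have ran: "?W ` space M \<subseteq> S \<times> T"
    using U V by (auto simp: measurable_count_space_eq2)
  have joint: "?W -` {(u, v)} \<inter> space M = {\<omega> \<in> space M. U \<omega> = u \<and> V \<omega> = v}"
    and marginal: "V -` {v} \<inter> space M = {\<omega> \<in> space M. V \<omega> = v}" for u v
    by auto
  have "cond_shannon M U V = - (\<Sum>w\<in>?W ` space M. ?h w)"
    unfolding cond_shannon_def
    by (simp add: conditional_entropy_eq[OF simple_distributed_prob[OF sV]
          simple_distributed_prob[OF simple_function_Pair[OF sU sV]]] case_prod_beta)
  also have "(\<Sum>w\<in>?W ` space M. ?h w) = (\<Sum>w\<in>S \<times> T. ?h w)"
    by (rule sum.mono_neutral_left) (use U V ran in \<open>auto simp: prob_vimage_outside\<close>)
  also have "\<dots> = (\<Sum>v\<in>T. \<Sum>u\<in>S. ?h (u, v))"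
    by (simp add: sum.cartesian_product' sum.swap[of _ S T])
  finally show ?thesis
    by (simp add: joint marginal cond_prob_def)
qed

text \<open>The identity of information with entropy minus conditional entropy is applied with
  \<open>U\<close> first; symmetry of mutual information comes from reindexing the joint law along
  the swap of pairs.\<close>

lemma mutual_info_eq:
  assumes U: "simple_function M U" and V: "simple_function M V"
  shows "mutual_info M V U = shannon M U - cond_shannon M U V"
proof -
  interpret information_space M 2
    by unfold_locales simp
  let ?P = "\<lambda>u. prob (U -` {u} \<inter> space M)" and ?Q = "\<lambda>v. prob (V -` {v} \<inter> space M)"
  let ?R = "\<lambda>(u, v). prob ((\<lambda>\<omega>. (U \<omega>, V \<omega>)) -` {(u, v)} \<inter> space M)"
  note dU = simple_distributed_prob[OF U] and dV = simple_distributed_prob[OF V]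
  have dUV: "simple_distributed M (\<lambda>\<omega>. (U \<omega>, V \<omega>)) ?R"
    using simple_distributed_prob[OF simple_function_Pair[OF U V]] by (simp add: case_prod_unfold)
  have swap: "(\<lambda>w. prob ((\<lambda>\<omega>. (V \<omega>, U \<omega>)) -` {w} \<inter> space M)) = (\<lambda>(v, u). ?R (u, v))"
  proof
    fix w
    show "prob ((\<lambda>\<omega>. (V \<omega>, U \<omega>)) -` {w} \<inter> space M) = (case w of (v, u) \<Rightarrow> ?R (u, v))"
      by (cases w) (auto intro!: arg_cong[where f = prob])
  qed
  have dVU: "simple_distributed M (\<lambda>\<omega>. (V \<omega>, U \<omega>)) (\<lambda>(v, u). ?R (u, v))"
    using simple_distributed_prob[OF simple_function_Pair[OF V U]] unfolding swap .
  have image: "(\<lambda>\<omega>. (V \<omega>, U \<omega>)) ` space M = prod.swap ` (\<lambda>\<omega>. (U \<omega>, V \<omega>)) ` space M"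
    by (auto simp: image_image)
  have "mutual_info M V U = mutual_info M U V"
    unfolding mutual_info_def mutual_information_simple_distributed[OF dV dU dVU]
      mutual_information_simple_distributed[OF dU dV dUV] image
    by (subst sum.reindex) (auto simp: case_prod_beta mult.commute intro!: sum.cong)
  also have "\<dots> = shannon M U - cond_shannon M U V"
    unfolding mutual_info_def shannon_def cond_shannon_def
    by (rule mutual_information_eq_entropy_conditional_entropy[OF U V])
  finally show ?thesis .
qed

text \<open>Law of total probability: the level sets of \<open>U\<close> partition the space. It
  yields the law of \<open>J\<close> from that of \<open>F\<close>, the law of the outcome from its
  joint law with \<open>J\<close>, and the normalisation of \<open>q\<close>.\<close>

lemma sum_prob_joint:
  assumes U: "U \<in> measurable M (count_space S)" "finite S" and Q: "{\<omega> \<in> space M. Q \<omega>} \<in> events"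
  shows "(\<Sum>u\<in>S. \<P>(\<omega> in M. U \<omega> = u \<and> Q \<omega>)) = \<P>(\<omega> in M. Q \<omega>)"
proof -
  have "{\<omega> \<in> space M. Q \<omega>} = (\<Union>u\<in>S. {\<omega> \<in> space M. U \<omega> = u \<and> Q \<omega>})"
    using U by (auto simp: measurable_count_space_eq2)
  moreover have "prob (\<Union>u\<in>S. {\<omega> \<in> space M. U \<omega> = u \<and> Q \<omega>})
      = (\<Sum>u\<in>S. \<P>(\<omega> in M. U \<omega> = u \<and> Q \<omega>))"
  proof (rule finite_measure_finite_Union)
    show "(\<lambda>u. {\<omega> \<in> space M. U \<omega> = u \<and> Q \<omega>}) ` S \<subseteq> events"
    proof clarify
      fix u assume "u \<in> S"
      then have "(U -` {u} \<inter> space M) \<inter> {\<omega> \<in> space M. Q \<omega>} \<in> events"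
        using measurable_sets[OF U(1), of "{u}"] Q by auto
      then show "{\<omega> \<in> space M. U \<omega> = u \<and> Q \<omega>} \<in> events"
        by (rule back_subst[of "\<lambda>E. E \<in> events"]) auto
    qed
  qed (use U in \<open>auto simp: disjoint_family_on_def\<close>)
  ultimately show ?thesis by simp
qed

text \<open>Each conditional law is uniform on its support, so \<open>- log\<close> of the
  conditional probability is constant there.\<close>

lemma cond_shannon_flat:
  assumes U: "U \<in> measurable M (count_space S)" "finite S"
    and V: "V \<in> measurable M (count_space T)" "finite T"
    and flat: "\<And>u v. u \<in> S \<Longrightarrow> v \<in> T \<Longrightarrow> \<P>(\<omega> in M. U \<omega> = u \<bar> V \<omega> = v) \<in> {0, w v}"
  shows "cond_shannon M U V = - (\<Sum>v\<in>T. \<P>(\<omega> in M. V \<omega> = v) * log 2 (w v))"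
proof -
  have meas: "{\<omega> \<in> space M. U \<omega> = u} \<in> events" "{\<omega> \<in> space M. V \<omega> = v} \<in> events"
    if "u \<in> S" "v \<in> T" for u v
    using measurable_sets[OF U(1), of "{u}"] measurable_sets[OF V(1), of "{v}"] that
    by (auto simp: vimage_def Int_def conj_commute)
  have total: "(\<Sum>u\<in>S. \<P>(\<omega> in M. U \<omega> = u \<and> V \<omega> = v)) = \<P>(\<omega> in M. V \<omega> = v)" if v: "v \<in> T" for v
    by (rule sum_prob_joint[OF U]) (use measurable_sets[OF V(1), of "{v}"] v in \<open>simp add: vimage_def Int_def conj_commute\<close>)
  have pointwise: "\<P>(\<omega> in M. U \<omega> = u \<and> V \<omega> = v) * log 2 (\<P>(\<omega> in M. U \<omega> = u \<bar> V \<omega> = v))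
      = \<P>(\<omega> in M. U \<omega> = u \<and> V \<omega> = v) * log 2 (w v)" if uv: "u \<in> S" "v \<in> T" for u v
  proof (cases "\<P>(\<omega> in M. U \<omega> = u \<bar> V \<omega> = v) = 0")
    case True
    \<comment> \<open>A zero quotient also arises from a null conditioning event, through division
      by zero; by monotonicity the joint probability is 0 then as well.\<close>
    have "\<P>(\<omega> in M. U \<omega> = u \<and> V \<omega> = v) \<le> \<P>(\<omega> in M. V \<omega> = v)"
      by (rule finite_measure_mono) (use meas uv in auto)
    with True have "\<P>(\<omega> in M. U \<omega> = u \<and> V \<omega> = v) = 0"
      by (auto simp: cond_prob_def order_antisym_conv)
    then show ?thesis by simp
  next
    case False
    then show ?thesis using flat[OF uv] by simp
  qed
  have "(\<Sum>u\<in>S. \<P>(\<omega> in M. U \<omega> = u \<and> V \<omega> = v) * log 2 (\<P>(\<omega> in M. U \<omega> = u \<bar> V \<omega> = v)))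
      = \<P>(\<omega> in M. V \<omega> = v) * log 2 (w v)" if "v \<in> T" for v
    unfolding total[OF that, symmetric] sum_distrib_right
    by (rule sum.cong[OF refl]) (rule pointwise[OF _ that])
  then show ?thesis
    by (simp add: cond_shannon_eq_sum[OF U V])
qed

end

section \<open>Entropy and information of the measurement outcomes\<close>

theorem mainTheorem6:
  fixes G :: "('a, 'b) monoid_scheme"
    and M :: nat and d :: "nat \<Rightarrow> nat" and \<phi> :: "'a \<Rightarrow> nat \<Rightarrow> int"
    and X :: "'x set" and \<F> :: "('a \<Rightarrow> 'x) set"
    and \<J> :: "'j set" and H :: "'j \<Rightarrow> 'a set"
    and p :: "('a \<Rightarrow> 'x) \<Rightarrow> real"
    and \<Omega> :: "'w measure" and F :: "'w \<Rightarrow> 'a \<Rightarrow> 'x" and J :: "'w \<Rightarrow> 'j"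
    and c :: "'a \<Rightarrow> 'a \<Rightarrow> complex" and A :: "'j \<Rightarrow> ('a \<Rightarrow> 'x) set"
    and q :: "'j \<Rightarrow> real" and \<sigma> :: "'j \<Rightarrow> 'a oper" and \<rho> :: "nat \<Rightarrow> (nat \<Rightarrow> 'a) oper"
    and lam :: "(nat \<Rightarrow> 'a \<Rightarrow> complex) \<Rightarrow> real"
    and Y :: "nat \<Rightarrow> 'w \<Rightarrow> nat \<Rightarrow> 'a" and t :: nat
  defines "c \<equiv> chi G M d \<phi>"
    and "A \<equiv> \<lambda>j. hiding_class G \<F> (H j)"
  defines "q \<equiv> \<lambda>j. \<Sum>f\<in>A j. p f"
    and "\<sigma> \<equiv> \<lambda>j. class_state G X c p (A j)"
  defines "\<rho> \<equiv> \<lambda>s. mixture \<J> q (\<lambda>j. tensor_power s (\<sigma> j))"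
  defines "lam \<equiv> \<lambda>\<chi>s :: nat \<Rightarrow> 'a \<Rightarrow> complex.
      \<Sum>j | j \<in> \<J> \<and> (\<forall>i\<in>{1..t}. \<chi>s i \<in> annihilator G (H j)).
        q j * (real (card (H j)) / real (card (carrier G))) ^ t"
  assumes "comm_group G" and "finite (carrier G)"
    and "\<And>i. i \<in> {1..M} \<Longrightarrow> d i \<ge> 1" and "\<phi> \<in> iso G (cyclic_product M d)"
    and "finite \<F>" and "\<F> \<subseteq> carrier G \<rightarrow>\<^sub>E X"
    and "\<And>j. j \<in> \<J> \<Longrightarrow> subgroup (H j) G" and "inj_on H \<J>"
    and "\<And>j. j \<in> \<J> \<Longrightarrow> A j \<noteq> {}" and "\<F> = (\<Union>j\<in>\<J>. A j)"
    and "prob_space \<Omega>"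
    and "F \<in> measurable \<Omega> (count_space \<F>)"
    and "\<And>f. f \<in> \<F> \<Longrightarrow> \<P>(\<omega> in \<Omega>. F \<omega> = f) = p f"
    and "\<And>\<omega>. \<omega> \<in> space \<Omega> \<Longrightarrow> J \<omega> \<in> \<J> \<and> F \<omega> \<in> A (J \<omega>)"
    and "\<And>j. j \<in> \<J> \<Longrightarrow> q j > 0"
    and "\<And>s. s \<ge> 1 \<Longrightarrow> Y s \<in> measurable \<Omega> (count_space (tuples s (carrier G)))"
    and "\<And>s j gs. s \<ge> 1 \<Longrightarrow> j \<in> \<J> \<Longrightarrow> gs \<in> tuples s (carrier G) \<Longrightarrow>
          complex_of_real \<P>(\<omega> in \<Omega>. Y s \<omega> = gs \<bar> J \<omega> = j) = tensor_power s (\<sigma> j) gs gs"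
    and "t \<ge> 1"
  shows "(\<forall>j\<in>\<J>. diagonal_on (tuples t (carrier G)) (tensor_power t (\<sigma> j)))
      \<and> diagonal_on (tuples t (carrier G)) (\<rho> t)
      \<and> bij_betw (\<lambda>gs. \<lambda>i\<in>{1..t}. c (gs i)) (tuples t (carrier G)) (tuples t (characters G))
      \<and> (\<forall>gs\<in>tuples t (carrier G). \<rho> t gs gs = of_real (lam (\<lambda>i\<in>{1..t}. c (gs i))))
      \<and> eigenvalues (tuples t (carrier G)) (\<rho> t)
          = image_mset (\<lambda>\<chi>s. of_real (lam \<chi>s)) (mset_set (tuples t (characters G)))
      \<and> shannon \<Omega> (Y t) = von_neumann_entropy (tuples t (carrier G)) (\<rho> t)
      \<and> cond_shannon \<Omega> (Y t) J = real t * cond_shannon \<Omega> (Y 1) J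
      \<and> real t * cond_shannon \<Omega> (Y 1) J
          = real t * (log 2 (real (card (carrier G))) - (\<Sum>j\<in>\<J>. q j * log 2 (real (card (H j)))))
      \<and> mutual_info \<Omega> J (Y t)
          = von_neumann_entropy (tuples t (carrier G)) (\<rho> t) - real t * cond_shannon \<Omega> (Y 1) J
      \<and> von_neumann_entropy (tuples t (carrier G)) (\<rho> t) - real t * cond_shannon \<Omega> (Y 1) J
          = holevo (tuples t (carrier G)) \<J> q (\<lambda>j. tensor_power t (\<sigma> j))"
proof -
  interpret prob_space \<Omega> by fact
  interpret group G using \<open>comm_group G\<close> by (simp add: comm_group_def)
  note finG = \<open>finite (carrier G)\<close> and t = \<open>t \<ge> 1\<close>
  have AF: "A j \<subseteq> \<F>" and A_hides: "\<And>f. f \<in> A j \<Longrightarrow> hides G f (H j)" for j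
    by (auto simp: A_def hiding_class_def)
  have disjoint: "j = k" if "j \<in> \<J>" "k \<in> \<J>" "f \<in> A j" "f \<in> A k" for f j k
    using hides_unique[OF is_group A_hides[OF that(3)] A_hides[OF that(4)]] \<open>inj_on H \<J>\<close> that
    by (auto dest: inj_onD)
  \<comment> \<open>Choosing one function from each nonempty class embeds \<open>\<J>\<close> into
    the finite set \<open>\<F>\<close>, as the classes are disjoint.\<close>
  have finJ: "finite \<J>"
  proof -
    have "\<forall>j\<in>\<J>. \<exists>f. f \<in> A j"
      using assms(15) by auto
    then obtain f where f: "\<And>j. j \<in> \<J> \<Longrightarrow> f j \<in> A j"
      by metis
    then have "inj_on f \<J>"
      by (intro inj_onI) (metis disjoint)
    moreover have "f ` \<J> \<subseteq> \<F>"
      using f AF by auto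
    ultimately show ?thesis
      using \<open>finite \<F>\<close> finite_imageD finite_subset by metis
  qed
  have finT: "finite (tuples s (carrier G))" for s
    by (rule finite_tuples[OF finG])

  have c_bij: "bij_betw c (carrier G) (characters G)"
    unfolding c_def using assms(9,10) is_group by (intro bij_betw_chi) auto
  have c_char: "c g \<in> characters G" if "g \<in> carrier G" for g
    using bij_betwE[OF c_bij] that by auto
  have c_inj: "c g = c g' \<longleftrightarrow> g = g'" if "g \<in> carrier G" "g' \<in> carrier G" for g g'
    using inj_on_eq_iff[OF bij_betw_imp_inj_on[OF c_bij] that] .

  \<comment> \<open>Diagonal entries of the class states and of their mixture\<close>
  define r where "r = (\<lambda>j. real (card (H j)) / real (card (carrier G)))"
  have card_H: "card (H j) > 0" if "j \<in> \<J>" for j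
    using subgroup.finite_imp_card_positive[OF assms(13)[OF that] finG] .
  have card_G: "card (carrier G) > 0"
    using finG by (auto simp: card_gt_0_iff)
  have \<sigma>: "\<sigma> j g g' = (if g = g' \<and> c g \<in> annihilator G (H j) then of_real (r j) else 0)"
    if j: "j \<in> \<J>" and g: "g \<in> carrier G" "g' \<in> carrier G" for j g g'
  proof -
    have "f \<in> carrier G \<rightarrow> X" if "f \<in> A j" for f
      using that AF \<open>\<F> \<subseteq> carrier G \<rightarrow>\<^sub>E X\<close> by (auto simp: PiE_def)
    moreover have "(\<Sum>f\<in>A j. p f) \<noteq> 0"
      using assms(21)[OF j] by (simp add: q_def)
    ultimately have "\<sigma> j g g' = (if g = g' \<and> c g \<in> annihilator G (H j)
        then of_nat (card (H j)) / of_nat (card (carrier G)) else 0)"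
      unfolding \<sigma>_def using A_hides c_char c_inj g finG is_group
      by (intro class_state_eq[where X = X]) auto
    then show ?thesis
      by (auto simp: r_def)
  qed
  \<comment> \<open>A real version of the diagonal entries of the tensor power; it reappears as the
    conditional probability of \<open>gs\<close> given class \<open>j\<close>.\<close>
  define w where "w = (\<lambda>s j gs. if \<forall>i\<in>{1..s}. c (gs i) \<in> annihilator G (H j) then r j ^ s else 0)"
  have \<sigma>_power: "tensor_power s (\<sigma> j) gs gs = of_real (w s j gs)"
    if j: "j \<in> \<J>" and gs: "gs \<in> tuples s (carrier G)" for s j gs
  proof -
    have gsG: "gs i \<in> carrier G" if "i \<in> {1..s}" for i
      using gs that by (auto simp: tuples_def)
    show ?thesis
    proof (cases "\<forall>i\<in>{1..s}. c (gs i) \<in> annihilator G (H j)")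
      case True
      have "tensor_power s (\<sigma> j) gs gs = (\<Prod>i=1..s. of_real (r j))"
        unfolding tensor_power_def by (rule prod.cong) (use True gsG \<sigma>[OF j gsG gsG] in auto)
      then show ?thesis
        using True by (simp add: w_def)
    next
      case False
      then obtain i where i: "i \<in> {1..s}" "c (gs i) \<notin> annihilator G (H j)"
        by auto
      then have "\<sigma> j (gs i) (gs i) = 0"
        using \<sigma>[OF j gsG gsG] by auto
      then have "tensor_power s (\<sigma> j) gs gs = 0"
        unfolding tensor_power_def by (intro prod_zero) (use i in auto)
      then show ?thesis
        using False by (auto simp: w_def)
    qed
  qed
  have diag_\<sigma>: "diagonal_on (tuples s (carrier G)) (tensor_power s (\<sigma> j))" if "j \<in> \<J>" for s j
    by (rule tensor_power_diagonal) (use \<sigma>[OF that] in \<open>auto simp: diagonal_on_def\<close>)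
  have diag_\<rho>: "diagonal_on (tuples t (carrier G)) (\<rho> t)"
    unfolding \<rho>_def by (rule mixture_diagonal[OF diag_\<sigma>])
  have \<rho>_w: "\<rho> t gs gs = of_real (\<Sum>j\<in>\<J>. q j * w t j gs)" if "gs \<in> tuples t (carrier G)" for gs
    using \<sigma>_power that by (simp add: \<rho>_def mixture_def)
  have lam_w: "lam (\<lambda>i\<in>{1..t}. c (gs i)) = (\<Sum>j\<in>\<J>. q j * w t j gs)" for gs
  proof -
    have "lam (\<lambda>i\<in>{1..t}. c (gs i)) =
        (\<Sum>j | j \<in> \<J> \<and> (\<forall>i\<in>{1..t}. c (gs i) \<in> annihilator G (H j)). q j * r j ^ t)"
      by (simp add: lam_def r_def)
    also have "\<dots> = (\<Sum>j\<in>\<J>. if \<forall>i\<in>{1..t}. c (gs i) \<in> annihilator G (H j) then q j * r j ^ t else 0)"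
      by (rule sum.inter_filter[OF finJ])
    also have "\<dots> = (\<Sum>j\<in>\<J>. q j * w t j gs)"
      by (rule sum.cong) (auto simp: w_def)
    finally show ?thesis .
  qed
  have \<rho>_lam: "\<rho> t gs gs = of_real (lam (\<lambda>i\<in>{1..t}. c (gs i)))" if "gs \<in> tuples t (carrier G)" for gs
    using \<rho>_w[OF that] lam_w by simp
  have bij_tuples: "bij_betw (\<lambda>gs. \<lambda>i\<in>{1..t}. c (gs i)) (tuples t (carrier G)) (tuples t (characters G))"
    by (rule bij_betw_tuples[OF c_bij])
  have eig: "eigenvalues (tuples t (carrier G)) (\<rho> t)
      = image_mset (\<lambda>\<chi>s. of_real (lam \<chi>s)) (mset_set (tuples t (characters G)))"
  proof -
    \<comment> \<open>The diagonal entries are relabelled from basis tuples to character tuples; the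
      bijection keeps multiplicities.\<close>
    have "eigenvalues (tuples t (carrier G)) (\<rho> t) = image_mset (\<lambda>\<chi>s. of_real (lam \<chi>s))
        (image_mset (\<lambda>gs. \<lambda>i\<in>{1..t}. c (gs i)) (mset_set (tuples t (carrier G))))"
      unfolding eigenvalues_diagonal[OF finT diag_\<rho>] image_mset.compositionality
      by (rule image_mset_cong) (simp add: \<rho>_lam finT)
    then show ?thesis
      unfolding image_mset_mset_set[OF bij_betw_imp_inj_on[OF bij_tuples]]
        bij_betw_imp_surj_on[OF bij_tuples] .
  qed

  \<comment> \<open>Joint law of the class and the outcome\<close>
  have J_vimage: "{\<omega> \<in> space \<Omega>. J \<omega> = j} = F -` A j \<inter> space \<Omega>" if "j \<in> \<J>" for j
    using assms(20) disjoint that by blast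
  \<comment> \<open>The classes are disjoint, so \<open>J\<close> is a function of \<open>F\<close>
    and inherits its measurability.\<close>
  have J_event: "{\<omega> \<in> space \<Omega>. J \<omega> = j} \<in> events" if "j \<in> \<J>" for j
    unfolding J_vimage[OF that] by (rule measurable_sets[OF assms(18)]) (use AF in auto)
  have J_meas: "J \<in> measurable \<Omega> (count_space \<J>)"
    unfolding measurable_count_space_eq2[OF finJ]
    using assms(20) J_event by (auto simp: vimage_def Int_def conj_commute)
  have J_prob: "\<P>(\<omega> in \<Omega>. J \<omega> = j) = q j" if j: "j \<in> \<J>" for j
  proof -
    have "\<P>(\<omega> in \<Omega>. J \<omega> = j) = (\<Sum>f\<in>\<F>. \<P>(\<omega> in \<Omega>. F \<omega> = f \<and> J \<omega> = j))"
      by (rule sum_prob_joint[OF assms(18,11) J_event[OF j], symmetric])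
    also have "\<dots> = (\<Sum>f\<in>\<F>. if f \<in> A j then p f else 0)"
    proof (rule sum.cong[OF refl])
      fix f assume f: "f \<in> \<F>"
      have "{\<omega> \<in> space \<Omega>. F \<omega> = f \<and> J \<omega> = j} = (if f \<in> A j then {\<omega> \<in> space \<Omega>. F \<omega> = f} else {})"
        using J_vimage[OF j] by auto
      then show "\<P>(\<omega> in \<Omega>. F \<omega> = f \<and> J \<omega> = j) = (if f \<in> A j then p f else 0)"
        using assms(19)[OF f] by simp
    qed
    also have "\<dots> = q j"
      unfolding q_def using \<open>finite \<F>\<close> AF by (simp add: sum.If_cases Int_absorb1 Int_commute)
    finally show ?thesis .
  qed
  have q_sum: "(\<Sum>j\<in>\<J>. q j) = 1"
    using sum_prob_joint[OF J_meas finJ, of "\<lambda>_. True"] J_prob by (simp add: prob_space)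
  have cond: "\<P>(\<omega> in \<Omega>. Y s \<omega> = gs \<bar> J \<omega> = j) = w s j gs"
    if "s \<ge> 1" "j \<in> \<J>" "gs \<in> tuples s (carrier G)" for s j gs
    using assms(23)[OF that] \<sigma>_power[OF that(2,3)] by (simp only: of_real_eq_iff)
  \<comment> \<open>Positivity of \<open>q j\<close> permits multiplying the conditional probability
    back up.\<close>
  have joint: "\<P>(\<omega> in \<Omega>. Y s \<omega> = gs \<and> J \<omega> = j) = q j * w s j gs"
    if "s \<ge> 1" "j \<in> \<J>" "gs \<in> tuples s (carrier G)" for s j gs
    using cond[OF that] J_prob[OF that(2)] assms(21)[OF that(2)] by (simp add: cond_prob_def field_simps)

  have Y_prob: "prob (Y t -` {gs} \<inter> space \<Omega>) = (\<Sum>j\<in>\<J>. q j * w t j gs)"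
    if gs: "gs \<in> tuples t (carrier G)" for gs
  proof -
    have Y_event: "{\<omega> \<in> space \<Omega>. Y t \<omega> = gs} \<in> events"
      using measurable_sets[OF assms(22)[OF t], of "{gs}"] gs by (simp add: vimage_def Int_def conj_commute)
    have "prob (Y t -` {gs} \<inter> space \<Omega>) = \<P>(\<omega> in \<Omega>. Y t \<omega> = gs)"
      by (rule arg_cong[where f = prob]) auto
    also have "\<dots> = (\<Sum>j\<in>\<J>. \<P>(\<omega> in \<Omega>. J \<omega> = j \<and> Y t \<omega> = gs))"
      by (rule sum_prob_joint[OF J_meas finJ Y_event, symmetric])
    also have "\<dots> = (\<Sum>j\<in>\<J>. q j * w t j gs)"
      using joint[OF t _ gs] by (simp add: conj_commute)
    finally show ?thesis .
  qed
  \<comment> \<open>The outcome probabilities are the diagonal entries of the diagonal operator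
    \<open>\<rho> t\<close>, so both entropies are the same sum.\<close>
  have shannon: "shannon \<Omega> (Y t) = von_neumann_entropy (tuples t (carrier G)) (\<rho> t)"
    by (simp add: shannon_eq_sum[OF assms(22)[OF t] finT] von_neumann_entropy_diagonal[OF finT diag_\<rho>]
      Y_prob \<rho>_w)

  \<comment> \<open>Conditional entropy, mutual information and the Holevo quantity\<close>
  have cond_shannon: "cond_shannon \<Omega> (Y s) J
      = real s * (log 2 (real (card (carrier G))) - (\<Sum>j\<in>\<J>. q j * log 2 (real (card (H j)))))"
    if s: "s \<ge> 1" for s
  proof -
    \<comment> \<open>Given class \<open>j\<close>, every outcome has probability 0 or
      \<open>r j ^ s\<close>, so the number of copies enters only as an exponent.\<close>
    have "cond_shannon \<Omega> (Y s) J = - (\<Sum>j\<in>\<J>. \<P>(\<omega> in \<Omega>. J \<omega> = j) * log 2 (r j ^ s))"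
      by (rule cond_shannon_flat[OF assms(22)[OF s] finT J_meas finJ]) (simp add: cond[OF s] w_def)
    also have "\<dots> = - (\<Sum>j\<in>\<J>. q j * (real s * (log 2 (real (card (H j))) - log 2 (real (card (carrier G))))))"
    proof -
      have "log 2 (r j ^ s) = real s * (log 2 (real (card (H j))) - log 2 (real (card (carrier G))))"
        if "j \<in> \<J>" for j
        using card_H[OF that] card_G by (simp add: r_def log_nat_power log_divide)
      then show ?thesis
        by (simp add: J_prob)
    qed
    also have "\<dots> = real s * ((\<Sum>j\<in>\<J>. q j) * log 2 (real (card (carrier G))) - (\<Sum>j\<in>\<J>. q j * log 2 (real (card (H j)))))"
      by (simp add: sum_distrib_left sum_distrib_right sum_subtractf[symmetric] sum_negf[symmetric] algebra_simps)
    finally show ?thesis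
      by (simp add: q_sum)
  qed
  \<comment> \<open>Additivity is read off by comparing the closed formula at \<open>t\<close> and
    at 1.\<close>
  have cond_shannon_mult: "cond_shannon \<Omega> (Y t) J = real t * cond_shannon \<Omega> (Y 1) J"
    by (simp only: cond_shannon[OF t] cond_shannon[OF order_refl])
  \<comment> \<open>For fixed \<open>j\<close> the joint probability is \<open>q j\<close> times the
    conditional one, and the conditional probabilities are the spectrum of the diagonal class state,
    so the inner sum is a weighted von Neumann entropy.\<close>
  have "cond_shannon \<Omega> (Y t) J = (\<Sum>j\<in>\<J>. q j * von_neumann_entropy (tuples t (carrier G)) (tensor_power t (\<sigma> j)))"
    unfolding cond_shannon_eq_sum[OF assms(22)[OF t] finT J_meas finJ] sum_negf[symmetric]
    by (rule sum.cong) (simp_all add: joint[OF t] cond[OF t] von_neumann_entropy_diagonal[OF finT diag_\<sigma>]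
      \<sigma>_power sum_distrib_left mult.assoc sum_negf)
  then have holevo: "holevo (tuples t (carrier G)) \<J> q (\<lambda>j. tensor_power t (\<sigma> j))
      = von_neumann_entropy (tuples t (carrier G)) (\<rho> t) - cond_shannon \<Omega> (Y t) J"
    by (simp add: holevo_def \<rho>_def)
  have mutual: "mutual_info \<Omega> J (Y t) = shannon \<Omega> (Y t) - cond_shannon \<Omega> (Y t) J"
    by (intro mutual_info_eq simple_function_count_space[OF assms(22)[OF t] finT]
      simple_function_count_space[OF J_meas finJ])
  show ?thesis
    using diag_\<sigma> diag_\<rho> bij_tuples \<rho>_lam eig shannon cond_shannon_mult cond_shannon[of 1] holevo mutual
    by simp
qed

end
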